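(* Let $T$ be a signed tree with a matched vertex $u$ and let $\Gamma$ be a signed graph of order $n$ (disjoint from $T$). Then for each integer $k$ with $1\le k\le n$, and for every $k$-joining graph $T(u)\odot^{k}\Gamma$ of $T$ and $\Gamma$ with respect to $u$, $$\eta(T(u)\odot^{k}\Gamma)=\eta(T)+\eta(\Gamma).$$
   Context: A signed graph $\Gamma=(G,\sigma)$ consists of a finite simple graph $G=(V,E)$ (its underlying graph) and a map $\sigma:E\to\{+,-\}$. Its adjacency matrix is $A(\Gamma)=(a_{ij}^\sigma)$ with $a_{ij}^\sigma=\sigma(v_iv_j)a_{ij}$ (i.e. $\pm1$ according to the sign of the edge $v_iv_j$, and $0$ if $v_i,v_j$ are not adjacent), where $(a_{ij})$ is the adjacency matrix of $G$. The nullity $\eta(\Gamma)$ is the multiplicity of the eigenvalue $0$ of $A(\Gamma)$. The order is the number of vertices. A signed tree is a signed graph whose underlying graph is a tree. Matched/mismatched: for a signed tree $T$ on at least two vertices, a vertex $v$ of $T$ is mismatched in $T$ if there exists a maximum (cardinality) matching of $T$ that does not cover $v$; otherwise $v$ is matched in $T$. If a tree consists of only one vertex, this vertex is considered mismatched. $k$-joining graph: let $\Gamma_1$ be a signed graph containing a vertex $u$ and let $\Gamma_2$ be a signed graph of order $n$ disjoint from $\Gamma_1$. For $1\le k\le n$, a $k$-joining graph of $\Gamma_1$ and $\Gamma_2$ with respect to $u$, denoted $\Gamma_1(u)\odot^k\Gamma_2$, is obtained from $\Gamma_1\cup\Gamma_2$ by joining $u$ and arbitrary $k$ vertices of $\Gamma_2$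 with signed edges (of arbitrary signs). *)

theory Defs
  imports "Jordan_Normal_Form.Char_Poly"
begin

text \<open>
  AFP Graph_Theory represents undirected graphs by symmetric digraphs, where each edge is
  already a directed cycle of length two, so its notions of forest and tree do not apply.
  Graphs are therefore undirected here, with edges as two-element sets of vertices.
\<close>

record 'a graph =
  verts :: "'a set"
  edges :: "'a set set"

definition finite_simple_graph :: "('a, 'b) graph_scheme \<Rightarrow> bool" where
  "finite_simple_graph G \<longleftrightarrow>
     finite (verts G) \<and> (\<forall>e\<in>edges G. e \<subseteq> verts G \<and> card e = 2)"

definition adj_rel :: "('a, 'b) graph_scheme \<Rightarrow> ('a \<times> 'a) set" where
  "adj_rel G = {(x, y). {x, y} \<in> edges G}"

definition connected_graph :: "('a, 'b) graph_scheme \<Rightarrow> bool" where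
  "connected_graph G \<longleftrightarrow>
     verts G \<noteq> {} \<and> (\<forall>x\<in>verts G. \<forall>y\<in>verts G. (x, y) \<in> (adj_rel G)\<^sup>*)"

definition is_cycle :: "('a, 'b) graph_scheme \<Rightarrow> 'a list \<Rightarrow> bool" where
  "is_cycle G c \<longleftrightarrow>
     length c \<ge> 3 \<and> distinct c \<and>
     (\<forall>i<length c. {c ! i, c ! (Suc i mod length c)} \<in> edges G)"

definition is_tree :: "('a, 'b) graph_scheme \<Rightarrow> bool" where
  "is_tree G \<longleftrightarrow> finite_simple_graph G \<and> connected_graph G \<and> (\<nexists>c. is_cycle G c)"

definition matching :: "('a, 'b) graph_scheme \<Rightarrow> 'a set set \<Rightarrow> bool" where
  "matching G M \<longleftrightarrow> M \<subseteq> edges G \<and> pairwise disjnt M"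

definition maximum_matching :: "('a, 'b) graph_scheme \<Rightarrow> 'a set set \<Rightarrow> bool" where
  "maximum_matching G M \<longleftrightarrow> matching G M \<and> (\<forall>M'. matching G M' \<longrightarrow> card M' \<le> card M)"

definition mismatched :: "('a, 'b) graph_scheme \<Rightarrow> 'a \<Rightarrow> bool" where
  "mismatched T v \<longleftrightarrow>
     v \<in> verts T \<and> (card (verts T) = 1 \<or> (\<exists>M. maximum_matching T M \<and> v \<notin> \<Union>M))"

definition matched :: "('a, 'b) graph_scheme \<Rightarrow> 'a \<Rightarrow> bool" where
  "matched T v \<longleftrightarrow> v \<in> verts T \<and> \<not> mismatched T v"


datatype edge_sign = Pos | Neg

primrec sign_value :: "edge_sign \<Rightarrow> real" where
  "sign_value Pos = 1"
| "sign_value Neg = -1"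

text \<open>Values of \<open>esign\<close> outside the edge set are junk and never used.\<close>

record 'a signed_graph = "'a graph" +
  esign :: "'a set \<Rightarrow> edge_sign"

definition adj_entry :: "'a signed_graph \<Rightarrow> 'a \<Rightarrow> 'a \<Rightarrow> real" where
  "adj_entry \<Gamma> x y = (if {x, y} \<in> edges \<Gamma> then sign_value (esign \<Gamma> {x, y}) else 0)"

definition adj_matrix :: "'a signed_graph \<Rightarrow> 'a list \<Rightarrow> real mat" where
  "adj_matrix \<Gamma> vs =
     mat (length vs) (length vs) (\<lambda>(i, j). adj_entry \<Gamma> (vs ! i) (vs ! j))"

text \<open>
  Algebraic multiplicity of 0, i.e. its multiplicity as a root of the characteristic
  polynomial (it is 0 if 0 is not an eigenvalue). The chosen enumeration of the vertices is
  irrelevant, see \<open>nullity_eq\<close> below.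
\<close>

definition nullity :: "'a signed_graph \<Rightarrow> nat" where
  "nullity \<Gamma> =
     Polynomial.order 0
       (char_poly (adj_matrix \<Gamma> (SOME vs. distinct vs \<and> set vs = verts \<Gamma>)))"

lemma char_poly_adj_matrix_perm:
  assumes "distinct vs" "distinct ws" "set vs = set ws"
  shows "char_poly (adj_matrix \<Gamma> vs) = char_poly (adj_matrix \<Gamma> ws)"
proof -
  define n where "n = length vs"
  have lw: "length ws = n"
    using assms n_def by (metis distinct_card)
  define f where "f i = (THE j. j < n \<and> ws ! j = vs ! i)" for i
  have f: "f i < n \<and> ws ! f i = vs ! i" if "i < n" for i
  proof -
    have "vs ! i \<in> set ws" using that assms(3) n_def by (metis nth_mem)
    then obtain j where j: "j < n" "ws ! j = vs ! i" using lw by (metis in_set_conv_nth)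
    then have "\<exists>!j. j < n \<and> ws ! j = vs ! i"
      using assms(2) lw by (metis nth_eq_iff_index_eq)
    then show ?thesis unfolding f_def by (rule theI')
  qed
  have inj: "f i = f j \<Longrightarrow> i < n \<Longrightarrow> j < n \<Longrightarrow> i = j" for i j
    using f assms(1) n_def by (metis nth_eq_iff_index_eq)
  define P where "P = mat n n (\<lambda>(i, j). if f i = j then 1 else (0::real))"
  define Q where "Q = mat n n (\<lambda>(i, j). if f j = i then 1 else (0::real))"
  have PQ: "P * Q = 1\<^sub>m n"
    by (rule eq_matI)
       (use f inj in \<open>auto simp: P_def Q_def scalar_prod_def if_distrib[of "\<lambda>x. x * _"]
         sum.If_cases cong: if_cong\<close>)
  have cP: "P \<in> carrier_mat n n" and cQ: "Q \<in> carrier_mat n n" unfolding P_def Q_def by auto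
  have QP: "Q * P = 1\<^sub>m n"
    using mat_mult_left_right_inverse[OF cP cQ PQ] .
  let ?A = "adj_matrix \<Gamma> vs" and ?B = "adj_matrix \<Gamma> ws"
  have cA: "?A \<in> carrier_mat n n" and cB: "?B \<in> carrier_mat n n"
    using lw by (auto simp: adj_matrix_def n_def)
  have PB: "P * ?B = mat n n (\<lambda>(i, j). adj_entry \<Gamma> (vs ! i) (ws ! j))" (is "_ = ?R")
  proof (rule eq_matI)
    fix i j assume "i < dim_row ?R" "j < dim_col ?R"
    then have ij: "i < n" "j < n" by auto
    have "(P * ?B) $$ (i, j)
        = (\<Sum>k\<in>{0..<n}. (if f i = k then 1 else 0) * adj_entry \<Gamma> (ws ! k) (ws ! j))"
      using ij lw by (simp add: P_def adj_matrix_def scalar_prod_def)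
    also have "\<dots> = (\<Sum>k\<in>{0..<n}. if f i = k then adj_entry \<Gamma> (ws ! k) (ws ! j) else 0)"
      by (rule sum.cong) auto
    also have "\<dots> = adj_entry \<Gamma> (vs ! i) (ws ! j)"
      using f[OF ij(1)] by simp
    finally show "(P * ?B) $$ (i, j) = ?R $$ (i, j)"
      using ij by simp
  qed (use cP cB in auto)
  have "?A = P * ?B * Q"
  proof (rule eq_matI)
    fix i j assume "i < dim_row (P * ?B * Q)" "j < dim_col (P * ?B * Q)"
    then have ij: "i < n" "j < n" using cP cQ by auto
    have "(P * ?B * Q) $$ (i, j)
        = (\<Sum>k\<in>{0..<n}. adj_entry \<Gamma> (vs ! i) (ws ! k) * (if f j = k then 1 else 0))"
      unfolding PB using ij by (simp add: Q_def scalar_prod_def)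
    also have "\<dots> = (\<Sum>k\<in>{0..<n}. if f j = k then adj_entry \<Gamma> (vs ! i) (ws ! k) else 0)"
      by (rule sum.cong) auto
    also have "\<dots> = adj_entry \<Gamma> (vs ! i) (vs ! j)"
      using f[OF ij(2)] by simp
    finally show "?A $$ (i, j) = (P * ?B * Q) $$ (i, j)"
      using ij by (simp add: adj_matrix_def n_def)
  qed (use cA cP cQ in auto)
  then have "similar_mat ?A ?B"
    unfolding similar_mat_def similar_mat_wit_def Let_def
    using PQ QP cP cQ cA cB by (intro exI[of _ P] exI[of _ Q]) auto
  then show ?thesis by (rule char_poly_similar)
qed

lemma nullity_eq:
  assumes "distinct vs" "set vs = verts \<Gamma>"
  shows "nullity \<Gamma> = Polynomial.order 0 (char_poly (adj_matrix \<Gamma> vs))"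
proof -
  let ?ws = "SOME vs. distinct vs \<and> set vs = verts \<Gamma>"
  have "distinct ?ws \<and> set ?ws = verts \<Gamma>"
    by (rule someI[of _ vs]) (use assms in simp)
  then show ?thesis
    unfolding nullity_def using assms char_poly_adj_matrix_perm[of ?ws vs \<Gamma>] by simp
qed

text \<open>
  \<open>H\<close> is a \<open>k\<close>-joining graph of \<open>\<Gamma>\<^sub>1\<close> and \<open>\<Gamma>\<^sub>2\<close> with respect to \<open>u\<close>. Both graphs keep
  their signs; the signs of the \<open>k\<close> new edges are unconstrained.
\<close>

definition joining_graph ::
    "nat \<Rightarrow> 'a signed_graph \<Rightarrow> 'a \<Rightarrow> 'a signed_graph \<Rightarrow> 'a signed_graph \<Rightarrow> bool" where
  "joining_graph k \<Gamma>\<^sub>1 u \<Gamma>\<^sub>2 H \<longleftrightarrow>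
     u \<in> verts \<Gamma>\<^sub>1 \<and> disjnt (verts \<Gamma>\<^sub>1) (verts \<Gamma>\<^sub>2) \<and> 1 \<le> k \<and> k \<le> card (verts \<Gamma>\<^sub>2) \<and>
     verts H = verts \<Gamma>\<^sub>1 \<union> verts \<Gamma>\<^sub>2 \<and>
     (\<exists>S. S \<subseteq> verts \<Gamma>\<^sub>2 \<and> card S = k \<and>
          edges H = edges \<Gamma>\<^sub>1 \<union> edges \<Gamma>\<^sub>2 \<union> {{u, w} | w. w \<in> S}) \<and>
     (\<forall>e\<in>edges \<Gamma>\<^sub>1. esign H e = esign \<Gamma>\<^sub>1 e) \<and>
     (\<forall>e\<in>edges \<Gamma>\<^sub>2. esign H e = esign \<Gamma>\<^sub>2 e)"

end

theory Submission
  imports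
    Defs
    "Jordan_Normal_Form.Jordan_Normal_Form_Existence"
    "Jordan_Normal_Form.Jordan_Normal_Form_Uniqueness"
begin

text \<open>
  Write \<open>A\<close> and \<open>C\<close> for the adjacency matrices of \<open>T\<close> and \<open>\<Gamma>\<close>. Listing the vertices of \<open>T\<close>
  first, the adjacency matrix of the joined graph is the symmetric block matrix with diagonal
  blocks \<open>A\<close> and \<open>C\<close> and upper right block \<open>B = e c\<^sup>T\<close>, where \<open>e\<close> is the unit vector at \<open>u\<close> and
  \<open>c\<close> holds the signs of the new edges and \<open>0\<close> elsewhere. The point is that a matched \<open>u\<close> admits a vector \<open>y\<close> with
  \<open>A y = e\<close> and \<open>y\<^sub>u = 0\<close> (\<open>matched_standard_basis_solution\<close>). Then \<open>X = y c\<^sup>T\<close> satisfies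
  \<open>A X = B\<close>, so subtracting suitable multiples of the first block of columns from the second, and
  likewise for rows, clears the off-diagonal blocks; it turns \<open>C\<close> into \<open>C - B\<^sup>T X\<close>, which is \<open>C\<close>
  because \<open>B\<^sup>T X = y\<^sub>u c c\<^sup>T = 0\<close>. Hence the kernel of the joined matrix has the dimension of the
  kernel of the direct sum of \<open>A\<close> and \<open>C\<close> (\<open>kernel_dim_bordered\<close>). Nullity is an algebraic
  multiplicity; for real symmetric matrices it is the dimension of the kernel
  (\<open>order_char_poly_eq_kernel_dim\<close>).

  If there is no such \<open>y\<close>, then \<open>e\<close> is outside the span of the columns of \<open>A\<close> other than that of
  \<open>u\<close>, and some \<open>z\<close> with \<open>z\<^sub>u \<noteq> 0\<close> is orthogonal to all of these columns
  (\<open>in_span_or_separated\<close>). Given a maximum matching, such a \<open>z\<close> guides an alternating path that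
  starts at \<open>u\<close> with a matching edge: from a vertex \<open>w\<close> with \<open>z\<^sub>w \<noteq> 0\<close> go to its partner \<open>v\<close>; the
  equation at \<open>v\<close> has the nonzero term of \<open>w\<close>, hence another one, belonging to a neighbour \<open>x\<close> of
  \<open>v\<close> with \<open>z\<^sub>x \<noteq> 0\<close>. Without cycles the path never meets itself, so it stops, and it can only
  stop at an uncovered vertex. Exchanging matching and other edges along it gives a maximum
  matching that misses \<open>u\<close> (\<open>maximum_matching_avoiding_path_end\<close>), so \<open>u\<close> is mismatched.
\<close>

section \<open>Linear systems\<close>

text \<open>
  The Fredholm alternative for finitely many vectors, by induction on their number. If \<open>z\<close>
  separates \<open>b\<close> from the old vectors but not from the new one \<open>f j\<close>, then \<open>b\<close> is first moved along
  \<open>f j\<close> until it is orthogonal to \<open>z\<close>, and a vector separating the result is corrected by a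
  multiple of \<open>z\<close>.
\<close>

lemma in_span_or_separated:
  fixes f :: "'i \<Rightarrow> 'v \<Rightarrow> 'k::field"
  assumes "finite I" and V: "finite V"
  shows "(\<exists>c. \<forall>v\<in>V. b v = (\<Sum>i\<in>I. c i * f i v)) \<or>
    (\<exists>z. (\<forall>i\<in>I. (\<Sum>v\<in>V. z v * f i v) = 0) \<and> (\<Sum>v\<in>V. z v * b v) \<noteq> 0)"
  using assms(1)
proof (induction I arbitrary: b rule: finite_induct)
  case empty
  show ?case
  proof (cases "\<forall>v\<in>V. b v = 0")
    case False
    then obtain v where v: "v \<in> V" "b v \<noteq> 0" by auto
    have "(\<Sum>x\<in>V. (if x = v then 1 else 0) * b x) = b v"
      using v V by (simp add: if_distrib[of "\<lambda>t. t * _"] cong: if_cong)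
    then show ?thesis using v by auto
  qed auto
next
  case (insert j I)
  let ?p = "\<lambda>z g. \<Sum>v\<in>V. z v * (g v :: 'k)"
  have lift: "\<exists>c. \<forall>v\<in>V. b v = (\<Sum>i\<in>insert j I. c i * f i v)"
    if "\<forall>v\<in>V. b v - t * f j v = (\<Sum>i\<in>I. c i * f i v)" for c t
  proof (intro exI ballI)
    fix v assume "v \<in> V"
    then have "b v = t * f j v + (\<Sum>i\<in>I. c i * f i v)"
      using that by (metis add.commute diff_add_cancel)
    also have "(\<Sum>i\<in>I. c i * f i v) = (\<Sum>i\<in>I. (c(j := t)) i * f i v)"
      using insert.hyps by (intro sum.cong) auto
    finally show "b v = (\<Sum>i\<in>insert j I. (c(j := t)) i * f i v)"
      using insert.hyps by simp
  qed
  from insert.IH[of b] show ?case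
  proof (elim disjE exE conjE)
    fix c assume "\<forall>v\<in>V. b v = (\<Sum>i\<in>I. c i * f i v)"
    then show ?thesis using lift[of 0 c] by simp
  next
    fix z assume z: "\<forall>i\<in>I. ?p z (f i) = 0" "?p z b \<noteq> 0"
    show ?thesis
    proof (cases "?p z (f j) = 0")
      case True
      then show ?thesis using z by auto
    next
      case False
      \<comment> \<open>The value of \<open>t\<close> that makes \<open>b - t f j\<close> orthogonal to \<open>z\<close>.\<close>
      define t where "t = ?p z b / ?p z (f j)"
      from insert.IH[of "\<lambda>v. b v - t * f j v"] show ?thesis
      proof (elim disjE exE conjE)
        fix c assume "\<forall>v\<in>V. b v - t * f j v = (\<Sum>i\<in>I. c i * f i v)"
        then show ?thesis using lift by blast
      next
        fix z' assume z': "\<forall>i\<in>I. ?p z' (f i) = 0" "?p z' (\<lambda>v. b v - t * f j v) \<noteq> 0"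
        \<comment> \<open>The value of \<open>s\<close> that makes \<open>z' - s z\<close> orthogonal to \<open>f j\<close>.\<close>
        define s where "s = ?p z' (f j) / ?p z (f j)"
        define y where "y v = z' v - s * z v" for v
        have y: "?p y g = ?p z' g - s * ?p z g" for g
          by (simp add: y_def left_diff_distrib sum_subtractf sum_distrib_left mult.assoc)
        have "?p z' (\<lambda>v. b v - t * f j v) = ?p z' b - t * ?p z' (f j)"
          by (simp add: right_diff_distrib sum_subtractf sum_distrib_left algebra_simps)
        also have "\<dots> = ?p y b"
          by (simp add: y s_def t_def)
        finally have "?p y b \<noteq> 0" using z' by simp
        moreover have "\<forall>i\<in>insert j I. ?p y (f i) = 0"
          using z z' False by (auto simp: y s_def)
        ultimately show ?thesis by blast
      qed
    qed
  qed
qed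


section \<open>Alternating paths in forests\<close>

abbreviation edge_path :: "('a, 'b) graph_scheme \<Rightarrow> 'a list \<Rightarrow> bool" where
  "edge_path G \<equiv> successively (\<lambda>x y. {x, y} \<in> edges G)"

lemma cycle_if_chord:
  assumes path: "edge_path G (v # w # p)" and dist: "distinct (v # w # p)"
    and x: "x \<in> set p" "{v, x} \<in> edges G"
  shows "\<exists>c. is_cycle G c"
proof -
  obtain q r where p: "p = q @ x # r" using x(1) by (meson split_list)
  define c where "c = v # w # q @ [x]"
  have "v # w # p = c @ r" by (simp add: c_def p)
  then have c: "edge_path G c" "distinct c"
    using path dist by (metis successively_append_iff, metis distinct_append)
  have "{c ! i, c ! (Suc i mod length c)} \<in> edges G" if "i < length c" for i
  proof (cases "Suc i < length c")
    case True
    then show ?thesis using c(1) by (simp add: successively_conv_nth)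
  next
    case False
    then have "Suc i = length c" using that by simp
    then have "c ! i = x" by (simp add: c_def nth_append)
    with \<open>Suc i = length c\<close> x(2) show ?thesis by (simp add: c_def insert_commute)
  qed
  then have "is_cycle G c"
    using c unfolding is_cycle_def by (simp add: c_def)
  then show ?thesis ..
qed

lemma sum_zero_other_nonzero:
  fixes f :: "'a \<Rightarrow> 'b::comm_monoid_add"
  assumes "finite A" "sum f A = 0" "x \<in> A" "f x \<noteq> 0"
  shows "\<exists>y\<in>A. y \<noteq> x \<and> f y \<noteq> 0"
proof (rule ccontr)
  assume "\<not> ?thesis"
  then have "sum f (A - {x}) = 0" by (intro sum.neutral) auto
  then show False using assms by (simp add: sum.remove)
qed

lemma maximum_matching_exists:
  assumes "finite_simple_graph G"
  shows "\<exists>M. maximum_matching G M"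
proof -
  have fin: "finite (edges G)"
    using assms unfolding finite_simple_graph_def
    by (meson PowI finite_Pow_iff finite_subset subsetI)
  have "\<exists>M. matching G M \<and> (\<forall>M'. matching G M' \<longrightarrow> card M' \<le> card M)"
    by (rule ex_has_greatest_nat[where f = card and k = "{}" and b = "Suc (card (edges G))"])
      (auto simp: matching_def less_Suc_eq_le intro: card_mono[OF fin])
  then show ?thesis unfolding maximum_matching_def .
qed

lemma matching_unique_edge:
  "matching G M \<Longrightarrow> e \<in> M \<Longrightarrow> e' \<in> M \<Longrightarrow> x \<in> e \<Longrightarrow> x \<in> e' \<Longrightarrow> e = e'"
  unfolding matching_def pairwise_def disjnt_def by blast

lemma maximum_matching_swap:
  assumes M: "maximum_matching G M" and fin: "finite M"
    and wv: "{w, v} \<in> M" and edge: "{v, x} \<in> edges G" and x: "x \<notin> \<Union>M" and neq: "w \<noteq> v"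
  defines "M' \<equiv> insert {v, x} (M - {{w, v}})"
  shows "maximum_matching G M'" "w \<notin> \<Union>M'"
proof -
  have mM: "matching G M" using M unfolding maximum_matching_def by simp
  have only: "e = {w, v}" if "e \<in> M" "y \<in> e" "y \<in> {w, v}" for e y
    using matching_unique_edge[OF mM that(1) wv that(2,3)] .
  have "matching G M'"
    using mM edge x only unfolding M'_def matching_def pairwise_def disjnt_def by blast
  moreover have "card M' = card M"
  proof -
    have "{v, x} \<notin> M" using x by auto
    then show ?thesis using fin wv unfolding M'_def
      by (metis DiffD1 card.insert card_Suc_Diff1 finite_Diff)
  qed
  ultimately show "maximum_matching G M'"
    using M unfolding maximum_matching_def by simp
  show "w \<notin> \<Union>M'" using only x wv neq unfolding M'_def by blast
qed

text \<open>
  The lemma is meant for \<open>p = []\<close> and \<open>w = u\<close>. Its general form is what the induction passes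
  through: \<open>w # p\<close> is an alternating path out of \<open>u\<close>, listed from its current end \<open>w\<close> backwards, and
  \<open>M\<close> matches the vertices of \<open>p\<close> among themselves. The path grows by two edges at a time until
  its end is uncovered; on the way back every step exchanges one edge. Since edges of \<open>M\<close> inside
  \<open>p\<close> survive, the edge needed for the next exchange is still in the matching. The equations
  invoked are those at the partners of the successive ends; such a partner is always new, hence
  never \<open>u\<close>.
\<close>

lemma maximum_matching_avoiding_path_end:
  fixes a :: "'a \<Rightarrow> 'a \<Rightarrow> 'k::field"
  assumes G: "finite_simple_graph G" and acyclic: "\<nexists>c. is_cycle G c"
    and a: "\<And>x y. a x y \<noteq> 0 \<longleftrightarrow> {x, y} \<in> edges G"
    and z: "\<And>v. v \<in> verts G \<Longrightarrow> v \<noteq> u \<Longrightarrow> (\<Sum>x\<in>verts G. a v x * z x) = 0"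
    and M: "maximum_matching G M"
  shows "\<lbrakk>edge_path G (w # p); distinct (w # p); set (w # p) \<subseteq> verts G; u \<in> set (w # p);
      z w \<noteq> 0; \<forall>x\<in>set p. \<exists>y\<in>set p. {x, y} \<in> M\<rbrakk>
    \<Longrightarrow> \<exists>M'. maximum_matching G M' \<and> w \<notin> \<Union>M' \<and> (\<forall>e\<in>M. e \<subseteq> set p \<longrightarrow> e \<in> M')"
proof (induction "card (verts G) - length p" arbitrary: w p rule: less_induct)
  case less
  have fin: "finite (verts G)" and edge: "\<And>e. e \<in> edges G \<Longrightarrow> e \<subseteq> verts G \<and> card e = 2"
    using G unfolding finite_simple_graph_def by auto
  have mM: "matching G M" using M unfolding maximum_matching_def by simp
  show ?case
  proof (cases "w \<in> \<Union>M")
    case False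
    then show ?thesis using M by blast
  next
    case True
    then obtain e where e: "e \<in> M" "w \<in> e" by blast
    have eE: "e \<in> edges G" using e mM unfolding matching_def by blast
    then obtain v where ev: "e = {w, v}" and vw: "v \<noteq> w"
      using e(2) edge[OF eE] by (metis card_2_iff doubleton_eq_iff insertE singletonD)
    have wv: "{w, v} \<in> M" "{w, v} \<in> edges G" "v \<in> verts G"
      using e eE edge[OF eE] unfolding ev by auto
    \<comment> \<open>Vertices of \<open>p\<close> already have their partners in \<open>p\<close>, and \<open>w\<close> is not there.\<close>
    have v_new: "v \<notin> set p"
    proof
      assume "v \<in> set p"
      then obtain y where y: "y \<in> set p" "{v, y} \<in> M" using less.prems by blast
      then have "{v, y} = {w, v}" using matching_unique_edge[OF mM y(2) wv(1), of v] by simp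
      then show False using y less.prems(2) vw by (auto simp: doubleton_eq_iff)
    qed
    have "(\<Sum>x\<in>verts G. a v x * z x) = 0"
      using z wv v_new vw less.prems by auto
    moreover have "a v w * z w \<noteq> 0"
      using a wv less.prems(5) by (simp add: insert_commute)
    ultimately obtain x where x: "x \<in> verts G" "x \<noteq> w" "a v x * z x \<noteq> 0"
      using sum_zero_other_nonzero[OF fin, of "\<lambda>x. a v x * z x" w] less.prems(3) by auto
    have vx: "{v, x} \<in> edges G" "z x \<noteq> 0" using x a by auto
    have "x \<noteq> v" using edge[OF vx(1)] by auto
    have path: "edge_path G (v # w # p)" "distinct (v # w # p)"
      using less.prems wv v_new vw by (auto simp: insert_commute successively_Cons)
    have x_new: "x \<notin> set p"
      using cycle_if_chord[OF path _ vx(1)] acyclic by blast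
    have path': "edge_path G (x # v # w # p)" "distinct (x # v # w # p)"
      using path x_new x \<open>x \<noteq> v\<close> vx by (auto simp: insert_commute)
    have sub: "set (x # v # w # p) \<subseteq> verts G"
      using less.prems x wv by auto
    have "length (x # v # w # p) \<le> card (verts G)"
      using path'(2) sub fin by (metis card_mono distinct_card)
    then have "card (verts G) - length (v # w # p) < card (verts G) - length p" by simp
    moreover have "\<forall>y\<in>set (v # w # p). \<exists>y'\<in>set (v # w # p). {y, y'} \<in> M"
      using less.prems(6) wv by (auto simp: insert_commute)
    ultimately obtain N where N: "maximum_matching G N" "x \<notin> \<Union>N"
      "\<forall>e\<in>M. e \<subseteq> set (v # w # p) \<longrightarrow> e \<in> N"
      using less.hyps[of "v # w # p" x] path' sub less.prems(4) vx(2) by auto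
    have "finite N"
      using N(1) fin edge unfolding maximum_matching_def matching_def
      by (meson PowI finite_Pow_iff finite_subset subsetI)
    moreover have "{w, v} \<in> N" using N(3) wv by auto
    ultimately have swap: "maximum_matching G (insert {v, x} (N - {{w, v}}))"
      "w \<notin> \<Union>(insert {v, x} (N - {{w, v}}))"
      using maximum_matching_swap[OF N(1) _ _ vx(1) N(2)] vw by auto
    have "e \<in> insert {v, x} (N - {{w, v}})" if "e \<in> M" "e \<subseteq> set p" for e
      using that N(3) less.prems(2) by auto
    with swap show ?thesis by blast
  qed
qed

text \<open>
  The condition \<open>y u = 0\<close> is built in by allowing only the columns of the vertices other than \<open>u\<close>.
  In the alternative of the linear system, this leaves a separating vector whose equation at \<open>u\<close>
  may fail, which the alternating path argument tolerates.
\<close>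

lemma matched_standard_basis_solution:
  assumes T: "is_tree T" and u: "matched T u"
  obtains y where "y u = 0"
    "\<And>v. v \<in> verts T \<Longrightarrow> (\<Sum>w\<in>verts T. adj_entry T v w * y w) = (if v = u then 1 else 0)"
proof -
  have G: "finite_simple_graph T" "\<nexists>c. is_cycle T c" and fin: "finite (verts T)"
    using T unfolding is_tree_def finite_simple_graph_def by auto
  have uV: "u \<in> verts T" and covered: "\<And>M. maximum_matching T M \<Longrightarrow> u \<in> \<Union>M"
    using u unfolding matched_def mismatched_def by auto
  have sym: "adj_entry T v w = adj_entry T w v" for v w
    by (simp add: adj_entry_def insert_commute)
  have nz: "adj_entry T x y \<noteq> 0 \<longleftrightarrow> {x, y} \<in> edges T" for x y
    by (cases "esign T {x, y}") (auto simp: adj_entry_def)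
  let ?e = "\<lambda>v. if v = u then 1 else 0 :: real"
  have "finite (verts T - {u})" using fin by simp
  from in_span_or_separated[OF this fin, of ?e "\<lambda>w v. adj_entry T v w"]
  show ?thesis
  proof (elim disjE exE conjE)
    fix c assume c: "\<forall>v\<in>verts T. ?e v = (\<Sum>w\<in>verts T - {u}. c w * adj_entry T v w)"
    show ?thesis
    proof (rule that[of "c(u := 0)"])
      fix v assume "v \<in> verts T"
      have "(\<Sum>w\<in>verts T. adj_entry T v w * (c(u := 0)) w)
          = (\<Sum>w\<in>verts T - {u}. adj_entry T v w * (c(u := 0)) w)"
        using fin uV by (simp add: sum.remove)
      also have "\<dots> = (\<Sum>w\<in>verts T - {u}. c w * adj_entry T v w)"
        by (intro sum.cong) auto
      finally show "(\<Sum>w\<in>verts T. adj_entry T v w * (c(u := 0)) w) = ?e v"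
        using c \<open>v \<in> verts T\<close> by simp
    qed simp
  next
    fix z assume z: "\<forall>w\<in>verts T - {u}. (\<Sum>v\<in>verts T. z v * adj_entry T v w) = 0"
      and zu: "(\<Sum>v\<in>verts T. z v * ?e v) \<noteq> 0"
    have zu: "z u \<noteq> 0"
      using zu fin uV by (simp add: if_distrib[of "\<lambda>t. _ * t"] cong: if_cong)
    have "(\<Sum>x\<in>verts T. adj_entry T v x * z x) = 0" if "v \<in> verts T" "v \<noteq> u" for v
      using z that by (simp add: sym[of v] mult.commute)
    moreover obtain M where "maximum_matching T M"
      using maximum_matching_exists[OF G(1)] ..
    ultimately obtain M' where "maximum_matching T M'" "u \<notin> \<Union>M'"
      using maximum_matching_avoiding_path_end[OF G nz, of u z M u "[]"] uV zu by auto
    then show ?thesis using covered by blast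
  qed
qed


section \<open>Nullity of real symmetric matrices\<close>

text \<open>
  With \<open>w = B v\<close>, the matrix \<open>B\<close> is Hermitian and \<open>\<parallel>w\<parallel>\<^sup>2 = \<langle>v, B w\<rangle> = 0\<close>, so \<open>w = 0\<close>. The passage to complex
  matrices provides a Jordan normal form below.
\<close>

lemma real_symmetric_kernel_square:
  fixes A :: "real mat"
  assumes A: "A \<in> carrier_mat n n" and sym: "A\<^sup>T = A"
  defines "B \<equiv> map_mat complex_of_real A"
  assumes v: "v \<in> carrier_vec n" and BBv: "B *\<^sub>v (B *\<^sub>v v) = 0\<^sub>v n"
  shows "B *\<^sub>v v = 0\<^sub>v n"
proof -
  have B: "B \<in> carrier_mat n n" using A by (simp add: B_def)
  have symB: "B\<^sup>T = B" using sym by (metis B_def map_mat_transpose)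
  define w where "w = B *\<^sub>v v"
  have w: "w \<in> carrier_vec n" using B v by (simp add: w_def)
  have "B *\<^sub>v conjugate w = conjugate (B *\<^sub>v w)"
    by (rule eq_vecI) (use A w in \<open>auto simp: B_def scalar_prod_def\<close>)
  also have "\<dots> = 0\<^sub>v n" using BBv by (simp add: w_def)
  finally have Bw: "B *\<^sub>v conjugate w = 0\<^sub>v n" .
  have "w \<bullet>c w = (B *\<^sub>v v) \<bullet> conjugate w" by (simp add: w_def)
  also have "\<dots> = v \<bullet> (B *\<^sub>v conjugate w)"
    using transpose_vec_mult_scalar[OF B, of "conjugate w" v] B symB w v
    by (metis carrier_vec_conjugate comm_scalar_prod mult_mat_vec_carrier)
  also have "\<dots> = 0" using v by (simp add: Bw)
  finally show ?thesis
    using conjugate_square_eq_0_vec[OF w] by (simp add: w_def)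
qed

text \<open>
  The algebraic multiplicity is the total size of the Jordan blocks for \<open>0\<close>, which is the
  dimension of the kernel of any sufficiently high power; by the previous lemma all positive
  powers have the same kernel.
\<close>

lemma order_char_poly_eq_kernel_dim:
  fixes A :: "real mat"
  assumes A: "A \<in> carrier_mat n n" and sym: "A\<^sup>T = A"
  shows "Polynomial.order 0 (char_poly A) = kernel_dim (map_mat complex_of_real A)"
proof -
  define B where "B = map_mat complex_of_real A"
  have B: "B \<in> carrier_mat n n" using A by (simp add: B_def)
  have pow: "B ^\<^sub>m k \<in> carrier_mat n n" for k using B by simp
  have ker: "B *\<^sub>v v = 0\<^sub>v n" if "v \<in> carrier_vec n" "B ^\<^sub>m k *\<^sub>v (B *\<^sub>v v) = 0\<^sub>v n" for k v
    using that
  proof (induction k arbitrary: v)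
    case 0
    then show ?case using B by simp
  next
    case (Suc k)
    have Bv: "B *\<^sub>v v \<in> carrier_vec n" using B Suc.prems by simp
    have "B ^\<^sub>m k *\<^sub>v (B *\<^sub>v (B *\<^sub>v v)) = 0\<^sub>v n"
      using Suc.prems(2) assoc_mult_mat_vec[OF pow[of k] B Bv] by simp
    then have "B *\<^sub>v (B *\<^sub>v v) = 0\<^sub>v n" using Suc.IH[OF Bv] by simp
    then show ?case
      using real_symmetric_kernel_square[OF A sym Suc.prems(1)] by (simp add: B_def)
  qed
  have ker_pow: "mat_kernel (B ^\<^sub>m Suc k) = mat_kernel B" for k
  proof (rule subset_antisym)
    show "mat_kernel B \<subseteq> mat_kernel (B ^\<^sub>m Suc k)"
      using mat_kernel_mult_subset[OF B pow[of k]] by simp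
    show "mat_kernel (B ^\<^sub>m Suc k) \<subseteq> mat_kernel B"
    proof
      fix v assume "v \<in> mat_kernel (B ^\<^sub>m Suc k)"
      note v = mat_kernelD[OF pow this]
      have "B ^\<^sub>m k *\<^sub>v (B *\<^sub>v v) = 0\<^sub>v n"
        using v(2) assoc_mult_mat_vec[OF pow[of k] B v(1)] by simp
      from ker[OF v(1) this] show "v \<in> mat_kernel B"
        using v(1) by (intro mat_kernelI[OF B])
    qed
  qed
  obtain n_as where jnf: "jordan_nf B n_as"
    using jordan_nf_exists[OF B] char_poly_factorized[OF B] by blast
  define k where "k = sum_list (map fst n_as)"
  \<comment> \<open>No block is larger than \<open>k\<close>; the exponent \<open>Suc k\<close> is positive even without any blocks.\<close>
  have le: "m \<le> Suc k" if "(m, e) \<in> set n_as" for m e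
    using member_le_sum_list[of m "map fst n_as"] that unfolding k_def by force
  interpret map_poly_inj_idom_divide_hom complex_of_real ..
  have "Polynomial.order 0 (char_poly A) = Polynomial.order 0 (char_poly B)"
    using of_real_hom.char_poly_hom[OF A, where 'a = complex] order_hom[of 0 "char_poly A"]
    by (simp add: B_def)
  also have "\<dots> = sum_list (map fst (filter (\<lambda>na. snd na = 0) n_as))"
    by (rule jordan_nf_order[OF jnf])
  also have "\<dots> = (\<Sum>m\<leftarrow>map fst [(m, e)\<leftarrow>n_as. e = 0]. min (Suc k) m)"
    using le by (auto simp: case_prod_unfold o_def intro!: arg_cong[of _ _ sum_list] map_cong)
  also have "\<dots> = dim_gen_eigenspace B 0 (Suc k)"
    by (rule dim_gen_eigenspace[OF jnf, symmetric])
  also have "\<dots> = kernel_dim (B ^\<^sub>m Suc k)"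
  proof -
    have "char_matrix B 0 = B" using B by (auto simp: char_matrix_def)
    then show ?thesis unfolding dim_gen_eigenspace_def by simp
  qed
  also have "\<dots> = kernel_dim B"
    using ker_pow pow[of "Suc k"] B unfolding kernel_dim_def by simp
  finally show ?thesis unfolding B_def .
qed

lemma kernel_dim_equivalent:
  fixes M :: "'k::field mat"
  assumes M: "M \<in> carrier_mat n n" and L: "L \<in> carrier_mat n n" "L' \<in> carrier_mat n n"
    and P: "P \<in> carrier_mat n n" "P' \<in> carrier_mat n n"
    and inv: "L' * L = 1\<^sub>m n" "P * P' = 1\<^sub>m n"
  shows "kernel_dim (L * (M * P)) = kernel_dim M"
proof -
  have MP: "M * P \<in> carrier_mat n n" using M P by simp
  have "kernel_dim (L * (M * P)) = kernel_dim (M * P)"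
    using mat_kernel_mult_eq[OF MP L inv(1)] L P unfolding kernel_dim_def by simp
  also have "\<dots> = kernel_dim M"
    using mat_kernel_dim_mult_eq_right[OF M P inv(2)] M P unfolding kernel_dim_def by simp
  finally show ?thesis .
qed

text \<open>
  Block elimination: the column operation given by \<open>X\<close> clears \<open>B\<close> because \<open>A X = B\<close>, the
  transposed row operation clears \<open>B\<^sup>T\<close> because \<open>A\<close> is symmetric, and \<open>B\<^sup>T X = 0\<close> says that \<open>C\<close> is
  left unchanged.
\<close>

lemma kernel_dim_bordered:
  fixes A B C X :: "'k::field mat"
  assumes A: "A \<in> carrier_mat n n" and B: "B \<in> carrier_mat n m" and C: "C \<in> carrier_mat m m"
    and X: "X \<in> carrier_mat n m" and sym: "A\<^sup>T = A"
    and AX: "A * X = B" and BX: "B\<^sup>T * X = 0\<^sub>m m m"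
  shows "kernel_dim (four_block_mat A B B\<^sup>T C) = kernel_dim A + kernel_dim C"
proof -
  let ?M = "four_block_mat A B B\<^sup>T C"
  let ?up = "\<lambda>Y. four_block_mat (1\<^sub>m n) Y (0\<^sub>m m n) (1\<^sub>m m)"
  let ?lo = "\<lambda>Y. four_block_mat (1\<^sub>m n) (0\<^sub>m n m) Y (1\<^sub>m m)"
  have carr: "?M \<in> carrier_mat (n + m) (n + m)" "?up Y \<in> carrier_mat (n + m) (n + m)"
    "?lo Z \<in> carrier_mat (n + m) (n + m)" for Y Z
    using A B C by auto
  have XA: "X\<^sup>T * A = B\<^sup>T"
    using transpose_mult[OF A X] sym AX by simp
  have X': "- X \<in> carrier_mat n m" "- X\<^sup>T \<in> carrier_mat m n" "X\<^sup>T \<in> carrier_mat m n"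
    "B\<^sup>T \<in> carrier_mat m n" using X B by auto
  have one: "four_block_mat (1\<^sub>m n) (0\<^sub>m n m) (0\<^sub>m m n) (1\<^sub>m m) = (1\<^sub>m (n + m) :: 'k mat)"
    by (rule eq_matI) auto
  have cancel: "X + - X = 0\<^sub>m n m" "X\<^sup>T + - X\<^sup>T = 0\<^sub>m m n" "- 0\<^sub>m l l = (0\<^sub>m l l :: 'k mat)" for l
    using X by auto
  note block_mult = mult_four_block_mat[where ?nr1.0 = n and ?nr2.0 = m and ?n1.0 = n
      and ?n2.0 = m and ?nc1.0 = n and ?nc2.0 = m]
  have up: "?up (- X) * ?up X = 1\<^sub>m (n + m)"
    unfolding block_mult[OF one_carrier_mat X'(1) zero_carrier_mat one_carrier_mat
        one_carrier_mat X zero_carrier_mat one_carrier_mat]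
    using X by (simp add: cancel one)
  have lo: "?lo (X\<^sup>T) * ?lo (- X\<^sup>T) = 1\<^sub>m (n + m)"
    unfolding block_mult[OF one_carrier_mat zero_carrier_mat X'(3) one_carrier_mat
        one_carrier_mat zero_carrier_mat X'(2) one_carrier_mat]
    using X by (simp add: cancel one)
  have dims: "dim_col A = dim_row X" "dim_col B\<^sup>T = dim_row X" "dim_col X\<^sup>T = dim_row A"
    using A B X by simp_all
  have prods: "A * - X = - B" "B\<^sup>T * - X = - 0\<^sub>m m m" "- X\<^sup>T * A = - B\<^sup>T"
    unfolding uminus_mult_right_mat[OF dims(1)] uminus_mult_right_mat[OF dims(2)]
      uminus_mult_left_mat[OF dims(3)] AX BX XA by (rule refl)+
  have MP: "?M * ?up (- X) = four_block_mat A (0\<^sub>m n m) B\<^sup>T C"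
    unfolding block_mult[OF A B X'(4) C one_carrier_mat X'(1) zero_carrier_mat one_carrier_mat]
    using A B C X'(4) by (simp add: prods(1,2) cancel(3))
  have "?lo (- X\<^sup>T) * (?M * ?up (- X)) = four_block_mat A (0\<^sub>m n m) (0\<^sub>m m n) C"
    unfolding MP block_mult[OF one_carrier_mat zero_carrier_mat X'(2) one_carrier_mat
        A zero_carrier_mat X'(4) C]
    using A B C X'(2,4) by (simp add: prods(3))
  then have "kernel_dim ?M = kernel_dim (four_block_mat A (0\<^sub>m n m) (0\<^sub>m m n) C)"
    using kernel_dim_equivalent[OF carr(1) carr(3) carr(3) carr(2) carr(2) lo up] by simp
  also have "\<dots> = kernel_dim A + kernel_dim C"
    using kernel_four_block_0_mat[OF refl A C] A C unfolding kernel_dim_def by simp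
  finally show ?thesis .
qed

lemma order_char_poly_bordered:
  fixes A B C X :: "real mat"
  assumes A: "A \<in> carrier_mat n n" and B: "B \<in> carrier_mat n m" and C: "C \<in> carrier_mat m m"
    and X: "X \<in> carrier_mat n m" and symA: "A\<^sup>T = A" and symC: "C\<^sup>T = C"
    and AX: "A * X = B" and BX: "B\<^sup>T * X = 0\<^sub>m m m"
  shows "Polynomial.order 0 (char_poly (four_block_mat A B B\<^sup>T C))
    = Polynomial.order 0 (char_poly A) + Polynomial.order 0 (char_poly C)"
proof -
  let ?c = "map_mat complex_of_real"
  have M: "four_block_mat A B B\<^sup>T C \<in> carrier_mat (n + m) (n + m)"
    using A C by auto
  have sym: "(four_block_mat A B B\<^sup>T C)\<^sup>T = four_block_mat A B B\<^sup>T C"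
    using transpose_four_block_mat[OF A B _ C, of "B\<^sup>T"] B symA symC by simp
  have "?c (four_block_mat A B B\<^sup>T C) = four_block_mat (?c A) (?c B) (?c B)\<^sup>T (?c C)"
    using A B C by (intro eq_matI) auto
  moreover have "kernel_dim \<dots> = kernel_dim (?c A) + kernel_dim (?c C)"
  proof (rule kernel_dim_bordered)
    show "(?c A)\<^sup>T = ?c A" using symA by (metis map_mat_transpose)
    show "?c A * ?c X = ?c B"
      using of_real_hom.mat_hom_mult[OF A X, symmetric] unfolding AX .
    have "?c (B\<^sup>T * X) = ?c B\<^sup>T * ?c X"
      by (rule of_real_hom.mat_hom_mult) (use B X in auto)
    then have "(?c B)\<^sup>T * ?c X = ?c (B\<^sup>T * X)" by (simp add: map_mat_transpose)
    then show "(?c B)\<^sup>T * ?c X = 0\<^sub>m m m" unfolding BX by auto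
  qed (use A B C X in auto)
  ultimately show ?thesis
    using order_char_poly_eq_kernel_dim[OF M sym] order_char_poly_eq_kernel_dim[OF A symA]
      order_char_poly_eq_kernel_dim[OF C symC] by simp
qed


section \<open>Joining at a matched vertex\<close>

lemma sum_nth_distinct:
  "distinct xs \<Longrightarrow> (\<Sum>i = 0..<length xs. f (xs ! i)) = sum f (set xs)"
  using sum.reindex_bij_betw[OF bij_betw_nth[of xs "{0..<length xs}" "set xs"], of f]
  by (simp add: atLeast0LessThan)

lemma adj_matrix_symmetric: "(adj_matrix \<Gamma> vs)\<^sup>T = adj_matrix \<Gamma> vs"
  by (rule eq_matI) (auto simp: adj_matrix_def adj_entry_def insert_commute)

lemma joining_graph_adj_entry:
  assumes G1: "finite_simple_graph \<Gamma>\<^sub>1" and G2: "finite_simple_graph \<Gamma>\<^sub>2"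
    and H: "joining_graph k \<Gamma>\<^sub>1 u \<Gamma>\<^sub>2 H"
  shows "x \<in> verts \<Gamma>\<^sub>1 \<Longrightarrow> y \<in> verts \<Gamma>\<^sub>1 \<Longrightarrow> adj_entry H x y = adj_entry \<Gamma>\<^sub>1 x y"
    and "x \<in> verts \<Gamma>\<^sub>2 \<Longrightarrow> y \<in> verts \<Gamma>\<^sub>2 \<Longrightarrow> adj_entry H x y = adj_entry \<Gamma>\<^sub>2 x y"
    and "x \<in> verts \<Gamma>\<^sub>1 \<Longrightarrow> x \<noteq> u \<Longrightarrow> y \<in> verts \<Gamma>\<^sub>2 \<Longrightarrow> adj_entry H x y = 0"
proof -
  obtain S where S: "S \<subseteq> verts \<Gamma>\<^sub>2"
    "edges H = edges \<Gamma>\<^sub>1 \<union> edges \<Gamma>\<^sub>2 \<union> {{u, w} | w. w \<in> S}"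
    using H unfolding joining_graph_def by blast
  have disj: "verts \<Gamma>\<^sub>1 \<inter> verts \<Gamma>\<^sub>2 = {}" and u: "u \<in> verts \<Gamma>\<^sub>1"
    and sign: "\<forall>e\<in>edges \<Gamma>\<^sub>1. esign H e = esign \<Gamma>\<^sub>1 e" "\<forall>e\<in>edges \<Gamma>\<^sub>2. esign H e = esign \<Gamma>\<^sub>2 e"
    using H unfolding joining_graph_def disjnt_def by auto
  have sub: "e \<in> edges \<Gamma>\<^sub>1 \<Longrightarrow> e \<subseteq> verts \<Gamma>\<^sub>1" "e \<in> edges \<Gamma>\<^sub>2 \<Longrightarrow> e \<subseteq> verts \<Gamma>\<^sub>2" for e
    using G1 G2 unfolding finite_simple_graph_def by auto
  show "adj_entry H x y = adj_entry \<Gamma>\<^sub>1 x y" if "x \<in> verts \<Gamma>\<^sub>1" "y \<in> verts \<Gamma>\<^sub>1"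
  proof -
    have "{x, y} \<in> edges H \<longleftrightarrow> {x, y} \<in> edges \<Gamma>\<^sub>1"
      using that S disj sub(2)[of "{x, y}"] by (auto simp: doubleton_eq_iff)
    then show ?thesis using sign by (simp add: adj_entry_def)
  qed
  show "adj_entry H x y = adj_entry \<Gamma>\<^sub>2 x y" if "x \<in> verts \<Gamma>\<^sub>2" "y \<in> verts \<Gamma>\<^sub>2"
  proof -
    have "{x, y} \<in> edges H \<longleftrightarrow> {x, y} \<in> edges \<Gamma>\<^sub>2"
      using that S disj u sub(1)[of "{x, y}"] by (auto simp: doubleton_eq_iff)
    then show ?thesis using sign by (simp add: adj_entry_def)
  qed
  show "adj_entry H x y = 0" if "x \<in> verts \<Gamma>\<^sub>1" "x \<noteq> u" "y \<in> verts \<Gamma>\<^sub>2"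
    using that S disj sub(1)[of "{x, y}"] sub(2)[of "{x, y}"]
    by (auto simp: adj_entry_def doubleton_eq_iff)
qed

theorem theorem2p9:
  fixes T \<Gamma> H :: "'a signed_graph" and u :: 'a and n k :: nat
  assumes "is_tree T"
    and "matched T u"
    and "finite_simple_graph \<Gamma>"
    and "card (verts \<Gamma>) = n"
    and "disjnt (verts T) (verts \<Gamma>)"
    and "1 \<le> k" and "k \<le> n"
    and "joining_graph k T u \<Gamma> H"
  shows "nullity H = nullity T + nullity \<Gamma>"
proof -
  have T: "finite_simple_graph T" using assms(1) unfolding is_tree_def by simp
  have fin: "finite (verts T)" "finite (verts \<Gamma>)"
    using T assms(3) unfolding finite_simple_graph_def by auto
  have uV: "u \<in> verts T" using assms(2) unfolding matched_def by simp
  obtain vs ws where vs: "set vs = verts T" "distinct vs" and ws: "set ws = verts \<Gamma>" "distinct ws"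
    using fin finite_distinct_list by metis
  obtain y where yu: "y u = 0" and y: "\<And>v. v \<in> verts T \<Longrightarrow>
      (\<Sum>w\<in>verts T. adj_entry T v w * y w) = (if v = u then 1 else 0)"
    using matched_standard_basis_solution[OF assms(1,2)] by blast
  note entry = joining_graph_adj_entry[OF T assms(3,8)]
  let ?p = "length vs" and ?q = "length ws"
  let ?c = "\<lambda>j. adj_entry H u (ws ! j)"
  \<comment> \<open>All rows of \<open>B\<close> vanish except that of \<open>u\<close>, and \<open>X\<close> is the outer product of \<open>y\<close> with that row.\<close>
  define A where "A = adj_matrix T vs"
  define C where "C = adj_matrix \<Gamma> ws"
  define B where "B = mat ?p ?q (\<lambda>(i, j). adj_entry H (vs ! i) (ws ! j))"
  define X where "X = mat ?p ?q (\<lambda>(i, j). y (vs ! i) * ?c j)"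
  have carr: "A \<in> carrier_mat ?p ?p" "B \<in> carrier_mat ?p ?q" "C \<in> carrier_mat ?q ?q"
    "X \<in> carrier_mat ?p ?q"
    by (auto simp: A_def B_def C_def X_def adj_matrix_def)
  have in_verts: "i < ?p \<Longrightarrow> vs ! i \<in> verts T" "j < ?q \<Longrightarrow> ws ! j \<in> verts \<Gamma>" for i j
    using vs ws by (metis nth_mem)+
  have B_entry: "adj_entry H v (ws ! j) = (if v = u then 1 else 0) * ?c j"
    if "v \<in> verts T" "j < ?q" for v j
    using entry(3) in_verts that by auto
  have "distinct (vs @ ws)" "set (vs @ ws) = verts H"
    using vs ws assms(5,8) unfolding joining_graph_def disjnt_def by auto
  then have "nullity H = Polynomial.order 0 (char_poly (adj_matrix H (vs @ ws)))"
    by (rule nullity_eq)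
  also have "adj_matrix H (vs @ ws) = four_block_mat A B B\<^sup>T C"
  proof (rule eq_matI)
    fix i j assume "i < dim_row (four_block_mat A B B\<^sup>T C)" "j < dim_col (four_block_mat A B B\<^sup>T C)"
    then have ij: "i < ?p + ?q" "j < ?p + ?q" using carr by auto
    have sym: "adj_entry H v w = adj_entry H w v" for v w
      by (simp add: adj_entry_def insert_commute)
    show "adj_matrix H (vs @ ws) $$ (i, j) = four_block_mat A B B\<^sup>T C $$ (i, j)"
      using ij in_verts entry(1,2) sym[of "ws ! (i - ?p)" "vs ! j"]
      by (auto simp: A_def B_def C_def adj_matrix_def nth_append)
  qed (use carr in \<open>auto simp: adj_matrix_def\<close>)
  also have "Polynomial.order 0 (char_poly (four_block_mat A B B\<^sup>T C))
      = Polynomial.order 0 (char_poly A) + Polynomial.order 0 (char_poly C)"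
  proof (rule order_char_poly_bordered[OF carr])
    show "A\<^sup>T = A" "C\<^sup>T = C" by (simp_all add: A_def C_def adj_matrix_symmetric)
    show "A * X = B"
    proof (rule eq_matI)
      fix i j assume "i < dim_row B" "j < dim_col B"
      then have ij: "i < ?p" "j < ?q" using carr by auto
      have "(A * X) $$ (i, j)
          = (\<Sum>l = 0..<?p. adj_entry T (vs ! i) (vs ! l) * (y (vs ! l) * ?c j))"
        using ij by (simp add: A_def X_def adj_matrix_def scalar_prod_def)
      also have "\<dots> = (\<Sum>w\<in>verts T. adj_entry T (vs ! i) w * (y w * ?c j))"
        using sum_nth_distinct[OF vs(2)] vs(1) by simp
      also have "\<dots> = (\<Sum>w\<in>verts T. adj_entry T (vs ! i) w * y w) * ?c j"
        by (simp add: sum_distrib_right mult.assoc)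
      also have "\<dots> = B $$ (i, j)"
        using ij y[OF in_verts(1)] B_entry[OF in_verts(1)] by (simp add: B_def)
      finally show "(A * X) $$ (i, j) = B $$ (i, j)" .
    qed (use carr in auto)
    show "B\<^sup>T * X = 0\<^sub>m ?q ?q"
    proof (rule eq_matI)
      fix i j assume "i < dim_row (0\<^sub>m ?q ?q :: real mat)" "j < dim_col (0\<^sub>m ?q ?q :: real mat)"
      then have ij: "i < ?q" "j < ?q" by auto
      have "(B\<^sup>T * X) $$ (i, j)
          = (\<Sum>l = 0..<?p. adj_entry H (vs ! l) (ws ! i) * (y (vs ! l) * ?c j))"
        using ij by (simp add: B_def X_def scalar_prod_def)
      also have "\<dots> = 0"
        using B_entry[OF in_verts(1) ij(1)] yu by (intro sum.neutral) auto
      finally show "(B\<^sup>T * X) $$ (i, j) = 0\<^sub>m ?q ?q $$ (i, j)" using ij by simp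
    qed (use carr in auto)
  qed
  also have "\<dots> = nullity T + nullity \<Gamma>"
    using nullity_eq[OF vs(2,1)] nullity_eq[OF ws(2,1)] by (simp add: A_def C_def)
  finally show ?thesis .
qed

end
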